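(* Let $(a_n)_{n \geq 1}$ be a strictly increasing sequence of positive integers. For every $\varepsilon > 0$ and almost all $\alpha \in [0,1]$ (with respect to Lebesgue measure), $$\delta_{\min}^{\alpha}(N) \leq \frac{N^{\varepsilon}}{C_N} \qquad \text{for all except finitely many } N.$$
   Context: For $\alpha \in [0,1]$ and $N \geq 2$, $\delta_{\min}^{\alpha}(N) = \min\{\|(a_m - a_n)\alpha\| : 1 \leq m,n \leq N,\ m \neq n\}$, where $\|x\|$ denotes the distance from $x$ to the nearest integer. Let $A_N = \{a_1,\dots,a_N\}$, $A_N - A_N = \{a-b : a,b \in A_N\}$, and $C_N = \#(A_N - A_N)$. *)

theory Defs
  imports "HOL-Analysis.Analysis"
begin

definition dist_nint :: "real \<Rightarrow> real" where
  "dist_nint x = \<bar>x - of_int (round x)\<bar>"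

definition delta_min :: "(nat \<Rightarrow> nat) \<Rightarrow> real \<Rightarrow> nat \<Rightarrow> real" where
  "delta_min a \<alpha> N = Min {dist_nint ((real (a m) - real (a n)) * \<alpha>) | m n.
       m \<in> {1..N} \<and> n \<in> {1..N} \<and> m \<noteq> n}"

definition diff_card :: "(nat \<Rightarrow> nat) \<Rightarrow> nat \<Rightarrow> nat" where
  "diff_card a N = card {int (a m) - int (a n) | m n. m \<in> {1..N} \<and> n \<in> {1..N}}"

end

theory Submission
  imports Defs
begin

text \<open>
  Let \<open>D\<close> be the set of positive differences of \<open>a\<^sub>1, \<dots>, a\<^sub>N\<close> and \<open>M = |D|\<close>, so \<open>C\<^sub>N = 2M + 1\<close>.
  For \<open>z \<in> D\<close> the set \<open>E\<^sub>z\<close> of \<open>\<alpha> \<in> [0,1)\<close> with \<open>\<parallel>z\<alpha>\<parallel> \<le> \<psi>\<close> has measure \<open>2\<psi>\<close>, and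
  \<open>|E\<^sub>z \<inter> E\<^sub>w| \<le> 4\<psi>\<^sup>2 + 2\<psi> gcd(z,w)/max(z,w)\<close>. By Chebyshev the set of \<open>\<alpha>\<close> outside all
  \<open>E\<^sub>z\<close> has measure at most \<open>S / (2\<psi>M\<^sup>2)\<close>, where \<open>S\<close> is the sum of \<open>gcd(z,w)/max(z,w)\<close> over \<open>D \<times> D\<close>.

  The sum is at most a constant times \<open>M powr (1 + \<delta>)\<close>: up to an error \<open>M\<^sup>2/H\<close> it is a quadratic form
  \<open>\<langle>T 1\<^sub>D, 1\<^sub>D\<rangle>\<close> of a self-adjoint operator on functions of positive rationals, so Cauchy--Schwarz
  bounds it by high moments \<open>\<langle>T\<^sup>q 1\<^sub>D, 1\<^sub>D\<rangle>\<close>, and these are controlled by counting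
  solutions of \<open>x\<^sub>1 \<cdots> x\<^sub>q = y\<^sub>1 \<cdots> y\<^sub>q\<close> with weights \<open>1 / (x\<^sub>1 \<cdots> x\<^sub>q)\<close>.

  Borel--Cantelli is then applied along the first \<open>N\<close> with \<open>C\<^sub>N \<ge> 2\<^sup>j\<close>; monotonicity of
  the minimal gap in \<open>N\<close> covers all \<open>N\<close> in between.
\<close>

section \<open>Words with equal products\<close>

lemma sum_le_sum_inj:
  fixes f :: "'a \<Rightarrow> real" and g :: "'b \<Rightarrow> real"
  assumes "inj_on \<phi> S" "\<phi> ` S \<subseteq> T" "finite T" "\<And>y. y \<in> T \<Longrightarrow> 0 \<le> g y"
    and "\<And>x. x \<in> S \<Longrightarrow> f x \<le> g (\<phi> x)"
  shows "sum f S \<le> sum g T"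
proof -
  have "sum f S \<le> sum (g \<circ> \<phi>) S" using assms(5) by (intro sum_mono) auto
  also have "\<dots> = sum g (\<phi> ` S)" using assms(1) by (simp add: sum.reindex)
  also have "\<dots> \<le> sum g T" using assms by (intro sum_mono2) auto
  finally show ?thesis .
qed

definition words :: "nat \<Rightarrow> nat \<Rightarrow> nat list set" where
  "words H q = {xs. set xs \<subseteq> {1..H} \<and> length xs = q}"

lemma finite_words [simp]: "finite (words H q)"
  unfolding words_def by (rule finite_lists_length_eq) simp

lemma words_0: "words H 0 = {[]}"
  by (auto simp: words_def)

lemma words_Suc: "words H (Suc q) = (\<lambda>(x, xs). x # xs) ` ({1..H} \<times> words H q)"
  by (auto simp: words_def length_Suc_conv image_iff)

lemma prod_list_words_pos: "xs \<in> words H q \<Longrightarrow> 0 < prod_list xs"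
  by (induction xs arbitrary: q) (auto simp: words_def)

lemma prod_list_eq_1_imp_replicate:
  fixes xs :: "nat list"
  shows "prod_list xs = 1 \<Longrightarrow> xs = replicate (length xs) 1"
  by (induction xs) auto

lemma append_in_words: "xs \<in> words H p \<Longrightarrow> ys \<in> words H q \<Longrightarrow> xs @ ys \<in> words H (p + q)"
  by (auto simp: words_def)

lemma sum_inverse_prod_list_words:
  "(\<Sum>xs\<in>words H q. 1 / real (prod_list xs)) = harm H ^ q"
proof (induction q)
  case (Suc q)
  have "(\<Sum>xs\<in>words H (Suc q). 1 / real (prod_list xs))
      = (\<Sum>(x, xs)\<in>{1..H} \<times> words H q. (1 / real x) * (1 / real (prod_list xs)))"
    unfolding words_Suc by (subst sum.reindex) (auto simp: inj_on_def case_prod_unfold)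
  also have "\<dots> = harm H * harm H ^ q"
    unfolding sum.cartesian_product[symmetric] sum_product[symmetric] Suc.IH
    by (simp add: harm_def inverse_eq_divide)
  finally show ?case by simp
qed (simp add: words_0)

lemma prod_list_map2_times:
  fixes ds es :: "nat list"
  shows "length ds = length es \<Longrightarrow> prod_list (map2 (*) ds es) = prod_list ds * prod_list es"
  by (induction ds es rule: list_induct2) (auto simp: algebra_simps)

text \<open>Letter by letter, a divisor \<open>y\<close> of \<open>x * prod_list xs'\<close> factors
  as \<open>d * y'\<close> with \<open>d dvd x\<close> and \<open>y' dvd prod_list xs'\<close>; the
  cofactor \<open>e\<close> in \<open>x = d * e\<close> becomes the letter of \<open>es\<close>.
  Both factors are at most \<open>x\<close>, so no letter leaves \<open>{1..H}\<close>.\<close>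

lemma words_split_divisor:
  assumes "xs \<in> words H p" "y dvd prod_list xs"
  shows "\<exists>ds\<in>words H p. \<exists>es\<in>words H p. xs = map2 (*) ds es \<and> prod_list ds = y"
  using assms
proof (induction p arbitrary: xs y)
  case (Suc p)
  from Suc.prems obtain x xs' where xs: "xs = x # xs'" "x \<in> {1..H}" "xs' \<in> words H p"
    by (auto simp: words_Suc)
  with Suc.prems(2) obtain d y' where y: "y = d * y'" "d dvd x" "y' dvd prod_list xs'"
    using division_decomp[of y x "prod_list xs'"] by auto
  obtain ds es where de: "ds \<in> words H p" "es \<in> words H p" "xs' = map2 (*) ds es" "prod_list ds = y'"
    using Suc.IH[OF xs(3) y(3)] by blast
  obtain e where e: "x = d * e" using y(2) by blast
  have "d \<le> x" "e \<le> x" using xs(2) e by (auto intro!: dvd_imp_le)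
  moreover have "0 < d" "0 < e" using xs(2) e by auto
  ultimately have "d \<in> {1..H}" "e \<in> {1..H}" using xs(2) by auto
  then have "d # ds \<in> words H (Suc p)" "e # es \<in> words H (Suc p)"
    using de by (auto simp: words_def)
  then show ?case
    using xs de e y by (intro bexI[of _ "d # ds"] bexI[of _ "e # es"]) auto
qed (auto simp: words_0)

text \<open>Splitting off the first letter \<open>y\<close> of \<open>ys\<close> factors \<open>xs\<close> letterwise as \<open>ds * es\<close> with
  \<open>\<Prod> ds = y\<close>; iterating, \<open>xs\<close> and \<open>ys\<close> become the row and column products of a matrix,
  and there are \<open>p * q\<close> free entries.\<close>

lemma sum_equal_products_le:
  "(\<Sum>(xs, ys) | xs \<in> words H p \<and> ys \<in> words H q \<and> prod_list xs = prod_list ys.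
      1 / real (prod_list xs)) \<le> harm H ^ (p * q)"
proof (induction q)
  case 0
  have "{(xs, ys). xs \<in> words H p \<and> ys \<in> words H 0 \<and> prod_list xs = prod_list ys} \<subseteq> {(replicate p 1, [])}"
    using prod_list_eq_1_imp_replicate by (auto simp: words_0 words_def)
  then have "(\<Sum>(xs, ys) | xs \<in> words H p \<and> ys \<in> words H 0 \<and> prod_list xs = prod_list ys.
      1 / real (prod_list xs)) \<le> (\<Sum>(xs, ys)\<in>{(replicate p 1, [] :: nat list)}. 1 / real (prod_list xs))"
    by (intro sum_mono2) auto
  then show ?case by simp
next
  case (Suc q)
  let ?S = "{(xs, ys). xs \<in> words H p \<and> ys \<in> words H (Suc q) \<and> prod_list xs = prod_list ys}"
  let ?T = "{(xs, ys). xs \<in> words H p \<and> ys \<in> words H q \<and> prod_list xs = prod_list ys}"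
  have finT: "finite ?T"
    by (rule finite_subset[of _ "words H p \<times> words H q"]) auto
  have finS: "finite ?S"
    by (rule finite_subset[of _ "words H p \<times> words H (Suc q)"]) auto
  have "(\<Sum>(xs, ys)\<in>?S. 1 / real (prod_list xs))
      \<le> (\<Sum>(ds, es, ys)\<in>words H p \<times> ?T. 1 / real (prod_list ds) * (1 / real (prod_list es)))"
  \<comment> \<open>Each pair on the left comes from at least one triple: the first letter of its
    second word is split off \<open>xs\<close> as \<open>prod_list ds\<close>, and
    \<open>prod_list xs = prod_list ds * prod_list es\<close> makes the weights agree.\<close>
  proof (rule sum_le_included[where i = "\<lambda>(ds, es, ys). (map2 (*) ds es, prod_list ds # ys)"])
    show "\<forall>x\<in>?S. \<exists>y\<in>words H p \<times> ?T. (case y of (ds, es, ys) \<Rightarrow> (map2 (*) ds es, prod_list ds # ys)) = x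
      \<and> (case x of (xs, ys) \<Rightarrow> 1 / real (prod_list xs))
        \<le> (case y of (ds, es, ys) \<Rightarrow> 1 / real (prod_list ds) * (1 / real (prod_list es)))"
    proof (safe, goal_cases)
      case (1 xs ys)
      then obtain y ys' where ys: "ys = y # ys'" "y \<in> {1..H}" "ys' \<in> words H q"
        by (auto simp: words_Suc)
      with 1 obtain ds es where de: "ds \<in> words H p" "es \<in> words H p" "xs = map2 (*) ds es" "prod_list ds = y"
        using words_split_divisor[of xs H p y] by auto
      have len: "length ds = length es" using de by (auto simp: words_def)
      have "prod_list es = prod_list ys'"
        using 1(3) ys de prod_list_map2_times[OF len] by auto
      then show ?case
        using de ys prod_list_map2_times[OF len]
        by (intro bexI[of _ "(ds, es, ys')"]) auto
    qed
  qed (use finS finT in auto)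
  also have "\<dots> = harm H ^ p * (\<Sum>(es, ys)\<in>?T. 1 / real (prod_list es))"
    unfolding sum_inverse_prod_list_words[symmetric] sum_product sum.cartesian_product
    by (rule sum.cong) auto
  also have "\<dots> \<le> harm H ^ p * harm H ^ (p * q)"
    using Suc.IH by (intro mult_left_mono) (auto simp: harm_nonneg)
  finally show ?case by (simp add: power_add)
qed

section \<open>GCD sums\<close>

lemma sum_collisions:
  fixes u :: "'a \<Rightarrow> real" and v :: "'b \<Rightarrow> real"
  assumes "finite A" "finite B" "finite V" "f ` A \<subseteq> V"
  shows "(\<Sum>N\<in>V. (\<Sum>x | x \<in> A \<and> f x = N. u x) * (\<Sum>y | y \<in> B \<and> g y = N. v y))
       = (\<Sum>(x, y) | x \<in> A \<and> y \<in> B \<and> f x = g y. u x * v y)"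
proof -
  have "(\<Sum>N\<in>V. (\<Sum>x | x \<in> A \<and> f x = N. u x) * (\<Sum>y | y \<in> B \<and> g y = N. v y))
      = (\<Sum>N\<in>V. \<Sum>x | x \<in> A \<and> f x = N. u x * (\<Sum>y | y \<in> B \<and> g y = f x. v y))"
    by (simp add: sum_distrib_right)
  also have "\<dots> = (\<Sum>x\<in>A. u x * (\<Sum>y | y \<in> B \<and> g y = f x. v y))"
    using assms by (intro sum.group) auto
  also have "\<dots> = (\<Sum>x\<in>A. \<Sum>y | y \<in> B \<and> g y = f x. u x * v y)"
    by (simp add: sum_distrib_left)
  also have "\<dots> = (\<Sum>(x, y)\<in>Sigma A (\<lambda>x. {y. y \<in> B \<and> g y = f x}). u x * v y)"
    using assms by (intro sum.Sigma) auto
  also have "Sigma A (\<lambda>x. {y. y \<in> B \<and> g y = f x}) = {(x, y). x \<in> A \<and> y \<in> B \<and> f x = g y}"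
    by auto
  finally show ?thesis .
qed

text \<open>Grouping by the common value \<open>N\<close> gives the sum of
  \<open>r z N * r w N\<close>, at most the average of the two sums of squares. In a sum of squares
  the multiplier cancels, so it runs over pairs with equal products and the weight becomes
  \<open>1 / prod_list xs\<close>.\<close>

lemma sum_proportional_products_le:
  assumes "0 < z" "0 < w"
  shows "(\<Sum>(xs, ys) | xs \<in> words H q \<and> ys \<in> words H q \<and> z * prod_list xs = w * prod_list ys.
           1 / sqrt (real (prod_list xs)) * (1 / sqrt (real (prod_list ys)))) \<le> harm H ^ (q * q)"
    (is "?lhs \<le> _")
proof -
  let ?W = "words H q"
  let ?u = "\<lambda>xs. 1 / sqrt (real (prod_list xs))"
  define r where "r z N = (\<Sum>xs | xs \<in> ?W \<and> z * prod_list xs = N. ?u xs)" for z N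
  define V where "V = (\<lambda>xs. z * prod_list xs) ` ?W \<union> (\<lambda>xs. w * prod_list xs) ` ?W"
  have V: "finite V" by (simp add: V_def)
  have diag: "(\<Sum>N\<in>V. r t N * r t N) \<le> harm H ^ (q * q)" if "t \<in> {z, w}" for t
  proof -
    have "(\<Sum>N\<in>V. r t N * r t N)
        = (\<Sum>(xs, ys) | xs \<in> ?W \<and> ys \<in> ?W \<and> t * prod_list xs = t * prod_list ys. ?u xs * ?u ys)"
      unfolding r_def using that by (intro sum_collisions V) (auto simp: V_def)
    also have "\<dots> = (\<Sum>(xs, ys) | xs \<in> ?W \<and> ys \<in> ?W \<and> prod_list xs = prod_list ys. 1 / real (prod_list xs))"
      using that assms by (intro sum.cong) auto
    finally show ?thesis using sum_equal_products_le[of H q q] by simp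
  qed
  have "?lhs = (\<Sum>N\<in>V. r z N * r w N)"
    unfolding r_def by (rule sum_collisions[symmetric]) (auto simp: V_def)
  also have "\<dots> \<le> (\<Sum>N\<in>V. (r z N * r z N + r w N * r w N) / 2)"
  proof (rule sum_mono)
    fix N show "r z N * r w N \<le> (r z N * r z N + r w N * r w N) / 2"
      using sum_squares_bound[of "r z N" "r w N"] by (simp add: power2_eq_square)
  qed
  also have "\<dots> = ((\<Sum>N\<in>V. r z N * r z N) + (\<Sum>N\<in>V. r w N * r w N)) / 2"
    by (simp add: sum.distrib sum_divide_distrib[symmetric])
  also have "\<dots> \<le> harm H ^ (q * q)"
    using diag[of z] diag[of w] by simp
  finally show ?thesis .
qed

text \<open>\<open>moment H D q\<close> is \<open>\<langle>T ^ q 1\<^sub>D, 1\<^sub>D\<rangle>\<close> for the self-adjoint operator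
  \<open>(T f) r = (\<Sum>x,y\<le>H. f (r x / y) / sqrt (x y))\<close> on functions of positive rationals.\<close>

definition moment :: "nat \<Rightarrow> nat set \<Rightarrow> nat \<Rightarrow> real" where
  "moment H D q = (\<Sum>w\<in>D. \<Sum>(z, xs, ys) | z \<in> D \<and> xs \<in> words H q \<and> ys \<in> words H q \<and>
      z * prod_list xs = w * prod_list ys. 1 / sqrt (real (prod_list xs) * real (prod_list ys)))"

lemma finite_moment_index [simp]:
  "finite D \<Longrightarrow> finite {(z, xs, ys). z \<in> D \<and> xs \<in> words H q \<and> ys \<in> words H q \<and> R z xs ys}"
  by (rule finite_subset[of _ "D \<times> words H q \<times> words H q"]) auto

lemma moment_nonneg: "0 \<le> moment H D q"
  unfolding moment_def by (intro sum_nonneg) auto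

lemma moment_le:
  assumes "finite D" "\<And>z. z \<in> D \<Longrightarrow> 0 < z"
  shows "moment H D q \<le> real (card D) ^ 2 * harm H ^ (q * q)"
proof -
  have "moment H D q = (\<Sum>w\<in>D. \<Sum>z\<in>D.
      \<Sum>(xs, ys) | xs \<in> words H q \<and> ys \<in> words H q \<and> z * prod_list xs = w * prod_list ys.
           1 / sqrt (real (prod_list xs)) * (1 / sqrt (real (prod_list ys))))"
    unfolding moment_def
  proof (rule sum.cong[OF refl], goal_cases)
    case (1 w)
    have "finite {(xs, ys). xs \<in> words H q \<and> ys \<in> words H q \<and> z * prod_list xs = w * prod_list ys}" for z
      by (rule finite_subset[of _ "words H q \<times> words H q"]) auto
    then show ?case
      by (subst sum.Sigma) (auto simp: assms real_sqrt_mult intro!: sum.cong)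
  qed
  also have "\<dots> \<le> (\<Sum>w\<in>D. \<Sum>z\<in>D. harm H ^ (q * q))"
    using assms by (intro sum_mono sum_proportional_products_le) auto
  finally show ?thesis by (simp add: power2_eq_square)
qed

text \<open>Cauchy--Schwarz over \<open>w \<in> D\<close> leaves the sum of squares of
  \<open>T ^ q 1_D\<close> over \<open>D\<close>. This is at most its sum of squares over all
  positive rationals, which is \<open>moment H D (2 * q)\<close> by self-adjointness.\<close>

lemma moment_squared_le:
  assumes "finite D" "\<And>z. z \<in> D \<Longrightarrow> 0 < z"
  shows "moment H D q ^ 2 \<le> real (card D) * moment H D (2 * q)"
proof -
  let ?W = "words H q"
  define J where "J w = {(z, xs, ys). z \<in> D \<and> xs \<in> ?W \<and> ys \<in> ?W \<and>
      z * prod_list xs = w * prod_list ys}" for w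
  define K where "K w = {(z, xs, ys). z \<in> D \<and> xs \<in> words H (2 * q) \<and> ys \<in> words H (2 * q) \<and>
      z * prod_list xs = w * prod_list ys}" for w
  define u :: "nat \<times> nat list \<times> nat list \<Rightarrow> real"
    where "u = (\<lambda>(z, xs, ys). 1 / sqrt (real (prod_list xs) * real (prod_list ys)))"
  \<comment> \<open>Cross-multiplying \<open>z * prod_list xs = w * prod_list ys\<close> with
    \<open>z' * prod_list xs' = w * prod_list ys'\<close> eliminates \<open>w\<close> and leaves a
    relation between \<open>z\<close> and \<open>z'\<close> with words of length
    \<open>2 * q\<close>.\<close>
  define \<phi> :: "nat \<times> (nat \<times> nat list \<times> nat list) \<times> (nat \<times> nat list \<times> nat list) \<Rightarrow> nat \<times> nat \<times> nat list \<times> nat list"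
    where "\<phi> = (\<lambda>(w, (z, xs, ys), (z', xs', ys')). (z', z, xs @ ys', xs' @ ys))"
  have [simp]: "finite (J w)" "finite (K w)" for w
    unfolding J_def K_def by (rule finite_moment_index[OF assms(1)])+
  have mom: "moment H D q = (\<Sum>w\<in>D. sum u (J w))" "moment H D (2 * q) = (\<Sum>w\<in>D. sum u (K w))"
    by (simp_all add: moment_def u_def J_def K_def case_prod_unfold)
  have "(\<Sum>w\<in>D. sum u (J w) ^ 2) = (\<Sum>w\<in>D. \<Sum>(s, t)\<in>J w \<times> J w. u s * u t)"
    by (simp add: power2_eq_square sum_product sum.cartesian_product)
  also have "\<dots> = (\<Sum>(w, s, t)\<in>Sigma D (\<lambda>w. J w \<times> J w). u s * u t)"
    using assms by (subst sum.Sigma) auto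
  also have "\<dots> \<le> (\<Sum>(w, s)\<in>Sigma D K. u s)"
  proof (rule sum_le_sum_inj[where \<phi> = \<phi>])
    show "inj_on \<phi> (Sigma D (\<lambda>w. J w \<times> J w))"
    proof (rule inj_onI)
      fix p p' assume p: "p \<in> Sigma D (\<lambda>w. J w \<times> J w)" "p' \<in> Sigma D (\<lambda>w. J w \<times> J w)" "\<phi> p = \<phi> p'"
      obtain w z xs ys z' xs' ys' where pe: "p = (w, (z, xs, ys), (z', xs', ys'))" by (cases p) auto
      obtain v y as bs y' as' bs' where pe': "p' = (v, (y, as, bs), (y', as', bs'))" by (cases p') auto
      have len: "length xs = length as" "length ys = length bs" "length xs' = length as'" "length ys' = length bs'"
        using p pe pe' by (auto simp: J_def words_def)
      have eq: "z = y" "z' = y'" "xs = as" "ys = bs" "xs' = as'" "ys' = bs'"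
        using p(3) len by (auto simp: pe pe' \<phi>_def)
      \<comment> \<open>The eliminated \<open>w\<close> is recovered from
        \<open>z * prod_list xs = w * prod_list ys\<close>, since the product of \<open>ys\<close>
        is positive.\<close>
      have "w * prod_list ys = v * prod_list ys" "0 < prod_list ys"
        using p pe pe' eq by (auto simp: J_def intro: prod_list_words_pos)
      then show "p = p'" using pe pe' eq by auto
    qed
    show "\<phi> ` Sigma D (\<lambda>w. J w \<times> J w) \<subseteq> Sigma D K"
    proof (clarsimp simp: \<phi>_def J_def K_def mult_2 append_in_words, goal_cases)
      case (1 w z xs ys z' xs' ys')
      have "z * (prod_list xs * prod_list ys') = w * prod_list ys * prod_list ys'"
        using 1 by (simp add: mult.assoc[symmetric])
      also have "\<dots> = w * prod_list ys' * prod_list ys"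
        by (simp add: ac_simps)
      also have "\<dots> = z' * (prod_list xs' * prod_list ys)"
        using 1 by (simp add: mult.assoc[symmetric])
      finally show ?case .
    qed
    show "(case x of (w, s, t) \<Rightarrow> u s * u t) \<le> (case \<phi> x of (w, s) \<Rightarrow> u s)" for x
      by (auto simp: \<phi>_def u_def real_sqrt_mult ac_simps split: prod.splits)
  qed (use assms in \<open>auto simp: u_def\<close>)
  also have "\<dots> = moment H D (2 * q)"
    unfolding mom using assms by (subst sum.Sigma) auto
  finally have "(\<Sum>w\<in>D. sum u (J w) ^ 2) * card D \<le> moment H D (2 * q) * card D"
    by (rule mult_right_mono) simp
  moreover have "moment H D q ^ 2 \<le> (\<Sum>w\<in>D. sum u (J w) ^ 2) * card D"
    unfolding mom by (rule sum_squared_le_sum_of_squares)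
  ultimately show ?thesis by (simp add: mult.commute)
qed

text \<open>Normalised by \<open>card D\<close>, the previous inequality says that the square of the
  ratio at \<open>q\<close> is at most the ratio at \<open>2 * q\<close>; \<open>k\<close> doublings
  starting from 1 give the claim.\<close>

lemma moment_power_le:
  assumes "finite D" "D \<noteq> {}" "\<And>z. z \<in> D \<Longrightarrow> 0 < z"
  shows "(moment H D 1 / card D) ^ (2 ^ k) \<le> moment H D (2 ^ k) / card D"
proof (induction k)
  case (Suc k)
  have M: "0 < real (card D)" using assms by (simp add: card_gt_0_iff)
  have "(moment H D 1 / card D) ^ (2 ^ Suc k) = ((moment H D 1 / card D) ^ (2 ^ k)) ^ 2"
    by (simp add: power_mult[symmetric] mult.commute)
  also have "\<dots> \<le> (moment H D (2 ^ k) / card D) ^ 2"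
    using Suc.IH by (intro power_mono) (auto simp: moment_nonneg)
  also have "\<dots> \<le> moment H D (2 ^ Suc k) / card D"
    using moment_squared_le[OF assms(1,3), where H = H and q = "2 ^ k"] M
    by (simp add: power_divide field_simps power2_eq_square)
  finally show ?case .
qed simp

text \<open>Put \<open>z' = z div gcd z w\<close> and \<open>w' = w div gcd z w\<close>. The summand
  is \<open>1 / max z' w'\<close>, at most \<open>1 / H\<close> once a quotient exceeds
  \<open>H\<close>. Otherwise the relation \<open>z * w' = w * z'\<close> is counted in
  \<open>moment H D 1\<close> with weight \<open>1 / sqrt (z' * w')\<close>, which is no
  smaller.\<close>

lemma gcd_sum_le_moment:
  assumes "finite D" "\<And>z. z \<in> D \<Longrightarrow> 0 < z" "0 < H"
  shows "(\<Sum>w\<in>D. \<Sum>z\<in>D. real (gcd z w) / real (max z w)) \<le> real (card D) ^ 2 / H + moment H D 1"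
proof -
  have "(\<Sum>z\<in>D. real (gcd z w) / real (max z w)) \<le> (\<Sum>z\<in>D. 1 / real H) +
    (\<Sum>(z, xs, ys) | z \<in> D \<and> xs \<in> words H 1 \<and> ys \<in> words H 1 \<and>
      z * prod_list xs = w * prod_list ys. 1 / sqrt (real (prod_list xs) * real (prod_list ys)))"
    (is "?L \<le> ?A + sum ?u ?J") if w: "w \<in> D" for w
  proof -
    let ?z = "\<lambda>z. z div gcd z w" and ?w = "\<lambda>z. w div gcd z w"
    define S where "S = {z \<in> D. ?z z \<le> H \<and> ?w z \<le> H}"
    have fin: "finite S" "S \<subseteq> D" using assms by (auto simp: S_def)
    have fac: "z = ?z z * gcd z w" "w = ?w z * gcd z w" "0 < ?z z" "0 < ?w z" "0 < gcd z w" if "z \<in> D" for z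
      using assms(2)[OF that] assms(2)[OF w] by (auto simp: div_greater_zero_iff dvd_imp_le)
    have quot: "real (gcd z w) / real (max z w) = 1 / real (max (?z z) (?w z))" if "z \<in> D" for z
    proof -
      have "max z w = max (?z z) (?w z) * gcd z w"
        by (simp add: nat_mult_max_left)
      then show ?thesis using fac(5)[OF that] by simp
    qed
    have "?L = (\<Sum>z\<in>D - S. real (gcd z w) / real (max z w)) + (\<Sum>z\<in>S. real (gcd z w) / real (max z w))"
      using fin assms by (simp add: sum.subset_diff)
    also have "(\<Sum>z\<in>D - S. real (gcd z w) / real (max z w)) \<le> (\<Sum>z\<in>D - S. 1 / real H)"
      using assms(3) by (intro sum_mono) (auto simp: quot S_def simp del: of_nat_max intro!: divide_left_mono)
    also have "\<dots> \<le> ?A" using assms by (intro sum_mono2) auto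
    also have "(\<Sum>z\<in>S. real (gcd z w) / real (max z w)) \<le> sum ?u ?J"
    proof (rule sum_le_sum_inj[where \<phi> = "\<lambda>z. (z, [?w z], [?z z])"])
      show "(\<lambda>z. (z, [?w z], [?z z])) ` S \<subseteq> ?J"
      proof (clarsimp, intro conjI, goal_cases)
        case (1 z) then show ?case by (simp add: S_def)
      next
        case (2 z) then show ?case using fac(4)[of z] by (auto simp: S_def words_def Suc_le_eq)
      next
        case (3 z) then show ?case using fac(3)[of z] by (auto simp: S_def words_def Suc_le_eq)
      next
        case (4 z) then show ?case by (simp add: div_mult_swap mult.commute)
      qed
      show "real (gcd z w) / real (max z w) \<le> ?u (z, [?w z], [?z z])" if "z \<in> S" for z
      proof -
        have z: "z \<in> D" using that fin by auto
        have "sqrt (real (?w z) * real (?z z)) \<le> sqrt (real (max (?z z) (?w z)) ^ 2)"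
          unfolding power2_eq_square by (intro real_sqrt_le_mono mult_mono) auto
        then show ?thesis
          unfolding quot[OF z] using fac(3,4)[OF z]
          by (auto simp del: of_nat_max intro!: divide_left_mono mult_pos_pos)
      qed
      show "finite ?J" by (rule finite_moment_index[OF assms(1)])
    qed (auto simp: inj_on_def)
    finally show ?thesis by simp
  qed
  then have "(\<Sum>w\<in>D. \<Sum>z\<in>D. real (gcd z w) / real (max z w)) \<le> (\<Sum>w\<in>D. (\<Sum>z\<in>D. 1 / real H) +
    (\<Sum>(z, xs, ys) | z \<in> D \<and> xs \<in> words H 1 \<and> ys \<in> words H 1 \<and>
      z * prod_list xs = w * prod_list ys. 1 / sqrt (real (prod_list xs) * real (prod_list ys))))"
    by (rule sum_mono)
  also have "\<dots> = real (card D) ^ 2 / H + moment H D 1"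
    by (simp add: moment_def sum.distrib power2_eq_square)
  finally show ?thesis .
qed

text \<open>\<open>harm n - ln n\<close> is decreasing and equals 1 at \<open>n = 1\<close>, which
  is index 0 of the shifted sequence.\<close>

lemma harm_le_ln: "0 < n \<Longrightarrow> harm n \<le> 1 + ln (real n)"
  using decseqD[OF decseq_harm_diff_ln, of 0 "n - 1"] by (cases n) (auto simp: harm_expand)

text \<open>Cutting off at \<open>H = card D\<close> makes the error linear in
  \<open>card D\<close>. Taking a \<open>q\<close>-th root of the moment bound leaves the factor
  \<open>m powr (1 / q) * harm m ^ q\<close>; as \<open>q\<close> depends only on
  \<open>\<delta>\<close>, each part is at most a constant times
  \<open>m powr (\<delta> / 2)\<close>.\<close>

theorem gcd_sum_bound:
  assumes "0 < \<delta>"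
  obtains C where "0 < C"
    and "\<And>D. finite D \<Longrightarrow> D \<noteq> {} \<Longrightarrow> (\<And>z. z \<in> D \<Longrightarrow> 0 < z) \<Longrightarrow>
      (\<Sum>w\<in>D. \<Sum>z\<in>D. real (gcd z w) / real (max z w)) \<le> C * real (card D) powr (1 + \<delta>)"
proof -
  \<comment> \<open>\<open>q\<close> has to be a power of two for the doubling argument, and large
    enough that \<open>m powr (1 / q)\<close> costs at most half of \<open>\<delta>\<close>.\<close>
  obtain k where k: "1 / (\<delta> / 2) < 2 ^ k" using real_arch_pow[of 2 "1 / (\<delta> / 2)"] by auto
  define q :: nat where "q = 2 ^ k"
  have q: "0 < q" "1 / real q \<le> \<delta> / 2" using k assms by (auto simp: q_def field_simps)
  \<comment> \<open>With this \<open>s\<close>, bounding \<open>harm m\<close> by a multiple of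
    \<open>m powr s\<close> and raising to the power \<open>q\<close> costs the other half of
    \<open>\<delta>\<close>.\<close>
  define s where "s = \<delta> / (2 * real q)"
  have s: "0 < s" "s * q = \<delta> / 2" using assms q by (auto simp: s_def)
  define C where "C = 1 + (1 + 1 / s) ^ q"
  show ?thesis
  proof (rule that)
    show "0 < C" using s by (auto simp: C_def intro!: add_pos_nonneg)
    fix D :: "nat set" assume D: "finite D" "D \<noteq> {}" "\<And>z. z \<in> D \<Longrightarrow> 0 < z"
    define m where "m = card D"
    have m: "0 < m" using D by (simp add: m_def card_gt_0_iff)
    then have m1: "1 \<le> real m" by simp
    have h: "harm m \<le> (1 + 1 / s) * real m powr s"
    proof -
      have "harm m \<le> 1 + ln (real m)" by (rule harm_le_ln[OF m])
      also have "\<dots> \<le> real m powr s + real m powr s / s"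
        using ln_powr_bound[OF m1 s(1)] ge_one_powr_ge_zero[of "real m" s] m1 s by simp
      finally show ?thesis by (simp add: algebra_simps)
    qed
    define P where "P = moment m D 1 / m"
    have P0: "0 \<le> P" by (simp add: P_def moment_nonneg)
    have "P ^ q \<le> moment m D q / m"
      using moment_power_le[OF D, where H = m and k = k] by (simp add: P_def m_def q_def)
    also have "\<dots> \<le> (real m ^ 2 * harm m ^ (q * q)) / m"
      using moment_le[OF D(1,3), where H = m and q = q] by (intro divide_right_mono) (auto simp: m_def)
    also have "\<dots> = (real m powr (1 / q) * harm m ^ q) ^ q"
    proof -
      have "(real m powr (1 / q)) ^ q = m" using m q by (simp add: powr_power)
      then show ?thesis
        using m by (simp add: power_mult_distrib power_mult[symmetric] power2_eq_square)
    qed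
    finally have "P \<le> real m powr (1 / q) * harm m ^ q"
      using q P0 by (subst (asm) power_mono_iff) (auto simp: harm_nonneg)
    also have "\<dots> \<le> real m powr (\<delta> / 2) * ((1 + 1 / s) * real m powr s) ^ q"
      using h m1 q by (intro mult_mono power_mono powr_mono) (auto simp: harm_nonneg)
    also have "\<dots> = (1 + 1 / s) ^ q * real m powr \<delta>"
    proof -
      have "(real m powr s) ^ q = real m powr (\<delta> / 2)" using m by (simp add: s(2)[symmetric] powr_power mult.commute)
      moreover have "real m powr (\<delta> / 2) * real m powr (\<delta> / 2) = real m powr \<delta>"
        by (simp add: powr_add[symmetric])
      ultimately show ?thesis by (simp add: power_mult_distrib)
    qed
    finally have P: "moment m D 1 \<le> (1 + 1 / s) ^ q * (real m powr \<delta> * m)"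
      using m by (simp add: P_def field_simps)
    have "(\<Sum>w\<in>D. \<Sum>z\<in>D. real (gcd z w) / real (max z w)) \<le> real m ^ 2 / m + moment m D 1"
      using gcd_sum_le_moment[OF D(1,3) m] by (simp add: m_def)
    also have "\<dots> \<le> 1 * (real m powr \<delta> * m) + (1 + 1 / s) ^ q * (real m powr \<delta> * m)"
      using P m ge_one_powr_ge_zero[of "real m" \<delta>] m1 assms by (intro add_mono) (auto simp: power2_eq_square)
    also have "\<dots> = C * real m powr (1 + \<delta>)"
      using m by (simp add: C_def powr_add algebra_simps)
    finally show "(\<Sum>w\<in>D. \<Sum>z\<in>D. real (gcd z w) / real (max z w)) \<le> C * real (card D) powr (1 + \<delta>)"
      by (simp add: m_def)
  qed
qed

section \<open>Measure of the approximation sets\<close>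

lemma dist_nint_le: "dist_nint x \<le> \<bar>x - of_int k\<bar>"
  unfolding dist_nint_def by (rule round_diff_minimal)

lemma dist_nint_add_of_int [simp]: "dist_nint (x + of_int k) = dist_nint x"
proof (rule antisym)
  show "dist_nint (x + of_int k) \<le> dist_nint x"
    using dist_nint_le[of "x + of_int k" "round x + k"] by (simp add: dist_nint_def)
  show "dist_nint x \<le> dist_nint (x + of_int k)"
    using dist_nint_le[of x "round (x + of_int k) - k"] by (simp add: dist_nint_def algebra_simps)
qed

lemma dist_nint_add_of_nat [simp]: "dist_nint (x + of_nat k) = dist_nint x"
  using dist_nint_add_of_int[of x "int k"] by simp

lemma dist_nint_le_half: "dist_nint x \<le> 1 / 2"
  unfolding dist_nint_def using of_int_round_abs_le[of x] by (simp add: abs_minus_commute)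

lemma borel_measurable_dist_nint [measurable]: "dist_nint \<in> borel_measurable borel"
  unfolding dist_nint_def[abs_def] round_def by measurable

lemma card_int_interval_le:
  fixes s t :: real
  assumes "s \<le> t"
  shows "finite {i :: int. s \<le> i \<and> i \<le> t}" "real (card {i :: int. s \<le> i \<and> i \<le> t}) \<le> t - s + 1"
proof -
  have eq: "{i :: int. s \<le> i \<and> i \<le> t} = {\<lceil>s\<rceil>..\<lfloor>t\<rfloor>}"
    by (auto simp: ceiling_le_iff le_floor_iff)
  show "finite {i :: int. s \<le> i \<and> i \<le> t}" unfolding eq by simp
  have "real (nat (\<lfloor>t\<rfloor> - \<lceil>s\<rceil> + 1)) \<le> t - s + 1"
    using assms by linarith
  then show "real (card {i :: int. s \<le> i \<and> i \<le> t}) \<le> t - s + 1"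
    unfolding eq by (simp add: algebra_simps)
qed

text \<open>After division by \<open>g = gcd z w\<close>, closeness puts the integer
  \<open>z' * k - w' * rnd k\<close> in an interval of length \<open>2 * \<psi> * w'\<close>. It
  determines \<open>k\<close> modulo \<open>w'\<close> because \<open>z'\<close> is invertible
  there, and each residue class has \<open>g\<close> members below \<open>w\<close>.\<close>

lemma card_multiples_near_int_le:
  fixes y \<psi> :: real and z w :: nat
  assumes "0 \<le> \<psi>" "0 < z" "0 < w"
  shows "real (card {k. k < w \<and> dist_nint (y + real z * real k / real w) \<le> \<psi>}) \<le> 2 * \<psi> * w + gcd z w"
proof -
  define g where "g = gcd z w"
  define z' w' where "z' = z div g" and "w' = w div g"
  have g: "0 < g" "z = g * z'" "w = g * w'" using assms by (auto simp: g_def z'_def w'_def)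
  have w': "0 < w'" using g assms by (cases w') auto
  have cop: "coprime z' w'" unfolding z'_def w'_def g_def using assms by (intro div_gcd_coprime) auto
  define A where "A = {k. k < w \<and> dist_nint (y + real z * real k / real w) \<le> \<psi>}"
  define B where "B = {i :: int. - w' * (y + \<psi>) \<le> i \<and> i \<le> w' * (\<psi> - y)}"
  define rnd where "rnd k = round (y + real z * real k / real w)" for k
  define f where "f k = (int (z' * k) - int w' * rnd k, k div w')" for k
  have "inj_on f A"
  proof (rule inj_onI)
    fix k l assume "f k = f l"
    then have eq: "int (z' * k) - int w' * rnd k = int (z' * l) - int w' * rnd l" and d: "k div w' = l div w'"
      by (auto simp: f_def)
    have "int w' dvd int z' * (int k - int l)"
      by (rule dvdI[of _ _ "rnd k - rnd l"]) (use eq in \<open>simp add: algebra_simps\<close>)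
    then have "int w' dvd int k - int l"
      using cop by (subst (asm) coprime_dvd_mult_right_iff) (auto simp: coprime_commute)
    then have "int k mod int w' = int l mod int w'" by (simp add: mod_eq_dvd_iff)
    then have "k mod w' = l mod w'" by (metis of_nat_mod of_nat_eq_iff)
    with d show "k = l" by (metis div_mult_mod_eq)
  qed
  moreover have "f ` A \<subseteq> B \<times> {..<g}"
  proof (clarsimp simp: f_def, intro conjI)
    fix k assume k: "k \<in> A"
    have "\<bar>y + real z * real k / real w - rnd k\<bar> \<le> \<psi>" using k by (simp add: A_def dist_nint_def rnd_def)
    moreover have "y + real z * real k / real w - rnd k = y + (real z' * real k - real w' * rnd k) / w'"
      using g w' by (simp add: field_simps)
    ultimately have "\<bar>y + (real z' * real k - real w' * rnd k) / w'\<bar> \<le> \<psi>" by simp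
    then show "int z' * int k - int w' * rnd k \<in> B"
      using w' by (auto simp: B_def abs_le_iff field_simps)
    show "k div w' < g" using k g w' by (simp add: A_def less_mult_imp_div_less)
  qed
  moreover have fin: "finite B" and cB: "real (card B) \<le> 2 * \<psi> * w' + 1"
    using card_int_interval_le[of "- w' * (y + \<psi>)" "w' * (\<psi> - y)"] assms
    by (auto simp: B_def algebra_simps)
  ultimately have "card A \<le> card (B \<times> {..<g})" by (intro card_inj_on_le) auto
  then have "real (card A) \<le> real (card B) * g"
    by (simp add: card_cartesian_product flip: of_nat_mult)
  also have "\<dots> \<le> (2 * \<psi> * w' + 1) * g" using cB by (intro mult_right_mono) auto
  also have "\<dots> = 2 * \<psi> * w + g" using g by (simp add: algebra_simps)
  finally show ?thesis by (simp add: A_def g_def)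
qed

section \<open>Splitting integrals over one period into equal pieces\<close>

lemma integrable_unit_interval:
  fixes f :: "real \<Rightarrow> real"
  assumes [measurable]: "f \<in> borel_measurable borel" and "\<And>x. \<bar>f x\<bar> \<le> B"
  shows "set_integrable lborel {0..<1} f"
  unfolding set_integrable_def
  by (rule integrableI_bounded_set_indicator[where B = B]) (use assms in auto)

text \<open>The summand at \<open>k\<close> is the indicator of
  \<open>\<lfloor>w * x\<rfloor> = k\<close>; half-open intervals make the pieces disjoint, so the
  identity holds at every point.\<close>

lemma unit_interval_partition:
  fixes x :: real
  assumes "0 < w"
  shows "indicator {0..<1} x = (\<Sum>k<w. indicator {0..<1} (real w * x - real k) :: real)"
proof -
  have eq: "indicator {0..<1} (real w * x - real k) = (if \<lfloor>real w * x\<rfloor> = int k then 1 else 0 :: real)" for k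
    by (auto simp: indicator_def floor_eq_iff)
  show ?thesis
  proof (cases "x \<in> {0..<1}")
    case True
    then have "0 \<le> \<lfloor>real w * x\<rfloor>" "\<lfloor>real w * x\<rfloor> < int w" using assms by (auto simp: floor_less_iff)
    then obtain k where k: "k < w" "\<lfloor>real w * x\<rfloor> = int k" by (metis nonneg_int_cases of_nat_less_iff)
    then show ?thesis using True unfolding eq k(2) by simp
  next
    case False
    have "\<lfloor>real w * x\<rfloor> \<noteq> int k" if "k < w" for k
    proof
      assume "\<lfloor>real w * x\<rfloor> = int k"
      then have k: "real k \<le> real w * x" "real w * x < real k + 1" by (auto simp: floor_eq_iff)
      have "real k + 1 \<le> real w" using that by simp
      then have "real w * x < real w * 1" using k by linarith
      moreover have "0 \<le> real w * x" using k by linarith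
      ultimately show False using False assms by (auto simp: zero_le_mult_iff)
    qed
    then show ?thesis using False unfolding eq by simp
  qed
qed

text \<open>On the \<open>k\<close>-th of \<open>w\<close> equal pieces, \<open>(x + k) / w\<close>
  is substituted for \<open>x\<close>. The gain is that \<open>w * ((x + k) / w) = x + k\<close>, so
  a condition on \<open>dist_nint (w * x)\<close> no longer depends on \<open>k\<close>.\<close>

lemma set_integral_unit_interval_split:
  fixes f :: "real \<Rightarrow> real"
  assumes [measurable]: "f \<in> borel_measurable borel" and B: "\<And>x. \<bar>f x\<bar> \<le> B" and w: "0 < w"
  shows "(LINT x:{0..<1}|lborel. f x) = (\<Sum>k<w. LINT x:{0..<1}|lborel. f ((x + real k) / real w)) / w"
proof -
  have int: "integrable lborel (\<lambda>x. indicator {0..<1} (real w * x - real k) * f x)" for k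
  proof -
    have "(\<lambda>x. indicator {0..<1} (real w * x - real k) * f x)
        = (\<lambda>x. indicator {real k / w..<(real k + 1) / w} x *\<^sub>R f x)"
      using w by (auto simp: indicator_def field_simps fun_eq_iff)
    moreover have "integrable lborel \<dots>"
      by (rule integrableI_bounded_set_indicator[where B = B]) (use B w in \<open>auto simp: divide_right_mono\<close>)
    ultimately show ?thesis by simp
  qed
  have "(LINT x:{0..<1}|lborel. f x) = (\<integral>x. (\<Sum>k<w. indicator {0..<1} (real w * x - real k) * f x) \<partial>lborel)"
    unfolding set_lebesgue_integral_def
    by (intro Bochner_Integration.integral_cong refl, subst unit_interval_partition[OF w])
       (simp add: sum_distrib_right)
  also have "\<dots> = (\<Sum>k<w. \<integral>x. indicator {0..<1} (real w * x - real k) * f x \<partial>lborel)"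
    using int by (rule Bochner_Integration.integral_sum)
  also have "\<dots> = (\<Sum>k<w. (LINT x:{0..<1}|lborel. f ((x + real k) / real w)) / w)"
  proof (rule sum.cong[OF refl])
    fix k
    have "real w * (real k / real w + 1 / real w * x) - real k = x"
      "real k / real w + 1 / real w * x = (x + real k) / real w" for x
      using w by (simp_all add: field_simps)
    then show "(\<integral>x. indicator {0..<1} (real w * x - real k) * f x \<partial>lborel)
        = (LINT x:{0..<1}|lborel. f ((x + real k) / real w)) / w"
      unfolding set_lebesgue_integral_def using w
      by (subst lborel_integral_real_affine[of "1 / real w" _ "real k / real w"]) simp_all
  qed
  finally show ?thesis by (simp add: sum_divide_distrib)
qed

text \<open>Half-open, so that the period splits exactly into equal pieces; the point 1 is discarded
  later as a null set.\<close>

definition hits :: "real \<Rightarrow> nat \<Rightarrow> real set" where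
  "hits \<psi> z = {x \<in> {0..<1}. dist_nint (real z * x) \<le> \<psi>}"

lemma hits_measurable [measurable]: "hits \<psi> z \<in> sets borel"
proof -
  have "hits \<psi> z = {0..<1} \<inter> {x \<in> space borel. dist_nint (real z * x) \<le> \<psi>}" by (auto simp: hits_def)
  also have "\<dots> \<in> sets borel" by measurable
  finally show ?thesis .
qed

lemma set_integral_hits:
  "(LINT x:{0..<1}|lborel. of_bool (dist_nint (real z * x) \<le> \<psi>)) = measure lborel (hits \<psi> z)"
proof -
  have "(LINT x:{0..<1}|lborel. of_bool (dist_nint (real z * x) \<le> \<psi>)) = (\<integral>x. (indicator (hits \<psi> z) x :: real) \<partial>lborel)"
    unfolding set_lebesgue_integral_def
    by (intro Bochner_Integration.integral_cong) (auto simp: hits_def indicator_def)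
  then show ?thesis by simp
qed

text \<open>Splitting into \<open>z\<close> pieces and periodicity reduce to \<open>z = 1\<close>,
  where the set is an interval of length \<open>\<psi>\<close> at each end of the unit interval;
  \<open>\<psi> < 1 / 2\<close> keeps the two disjoint.\<close>

lemma measure_hits:
  assumes "0 < z" "0 \<le> \<psi>" "\<psi> < 1 / 2"
  shows "measure lborel (hits \<psi> z) = 2 * \<psi>"
proof -
  have 1: "hits \<psi> 1 = {0..\<psi>} \<union> {1 - \<psi>..<1}"
  proof (intro set_eqI iffI)
    fix x assume x: "x \<in> hits \<psi> 1"
    then have "0 \<le> x" "x < 1" "\<bar>x - of_int (round x)\<bar> \<le> \<psi>" by (auto simp: hits_def dist_nint_def)
    moreover from this have "round x = 0 \<or> round x = 1" using assms by linarith
    ultimately show "x \<in> {0..\<psi>} \<union> {1 - \<psi>..<1}" by auto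
  next
    fix x assume "x \<in> {0..\<psi>} \<union> {1 - \<psi>..<1}"
    then show "x \<in> hits \<psi> 1"
      using dist_nint_le[of x 0] dist_nint_le[of x 1] assms by (auto simp: hits_def)
  qed
  have "measure lborel (hits \<psi> z) = (\<Sum>k<z. LINT x:{0..<1}|lborel. of_bool (dist_nint (real z * ((x + real k) / real z)) \<le> \<psi>)) / z"
    unfolding set_integral_hits[symmetric]
    by (rule set_integral_unit_interval_split[where B = 1]) (use assms in auto)
  also have "\<dots> = measure lborel (hits \<psi> 1)"
    using assms by (simp add: set_integral_hits[of 1, simplified])
  also have "\<dots> = measure lborel {0..\<psi>} + measure lborel {1 - \<psi>..<1}"
    unfolding 1 using assms by (intro measure_Union) auto
  finally show ?thesis using assms by simp
qed

text \<open>After splitting into \<open>w\<close> pieces the condition for \<open>w\<close> is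
  \<open>dist_nint x \<le> \<psi>\<close> on each piece, while for fixed \<open>x\<close> the
  condition for \<open>z\<close> holds on at most \<open>2 * \<psi> * w + gcd z w\<close> of them.
  Integrating over a set of measure \<open>2 * \<psi>\<close> and dividing by \<open>w\<close> gives
  the bound.\<close>

lemma measure_hits_Int_le:
  assumes "0 < z" "0 < w" "0 \<le> \<psi>" "\<psi> < 1 / 2"
  shows "measure lborel (hits \<psi> z \<inter> hits \<psi> w) \<le> 4 * \<psi>\<^sup>2 + 2 * \<psi> * (real (gcd z w) / real w)"
proof -
  let ?near = "\<lambda>x. of_bool (dist_nint x \<le> \<psi>) :: real"
  let ?c = "2 * \<psi> * w + gcd z w"
  have int: "set_integrable lborel {0..<1} (\<lambda>x. ?near (real z * x / w + real z * real k / w) * ?near x)" for k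
    by (rule integrable_unit_interval[where B = 1]) auto
  have "measure lborel (hits \<psi> z \<inter> hits \<psi> w) = (\<integral>x. indicator (hits \<psi> z \<inter> hits \<psi> w) x \<partial>lborel)"
    by simp
  also have "\<dots> = (LINT x:{0..<1}|lborel. ?near (real z * x) * ?near (real w * x))"
    unfolding set_lebesgue_integral_def
    by (intro Bochner_Integration.integral_cong) (auto simp: hits_def indicator_def)
  also have "\<dots> = (\<Sum>k<w. LINT x:{0..<1}|lborel. ?near (real z * ((x + real k) / w)) * ?near (real w * ((x + real k) / w))) / w"
    by (rule set_integral_unit_interval_split[where B = 1]) (use assms in auto)
  also have "\<dots> = (\<Sum>k<w. LINT x:{0..<1}|lborel. ?near (real z * x / w + real z * real k / w) * ?near x) / w"
    using assms by (simp add: algebra_simps add_divide_distrib)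
  also have "\<dots> = (LINT x:{0..<1}|lborel. (\<Sum>k<w. ?near (real z * x / w + real z * real k / w) * ?near x)) / w"
    unfolding set_lebesgue_integral_def scaleR_sum_right
    by (subst Bochner_Integration.integral_sum[OF int[unfolded set_integrable_def]]) (rule refl)
  also have "(LINT x:{0..<1}|lborel. (\<Sum>k<w. ?near (real z * x / w + real z * real k / w) * ?near x))
      \<le> (LINT x:{0..<1}|lborel. ?c * ?near x)"
  proof (rule set_integral_mono)
    show "(\<Sum>k<w. ?near (real z * x / w + real z * real k / w) * ?near x) \<le> ?c * ?near x" for x
    proof -
      have "(\<Sum>k<w. ?near (real z * x / w + real z * real k / w))
          = real (card {k. k < w \<and> dist_nint (real z * x / w + real z * real k / w) \<le> \<psi>})"
        by (simp add: Int_def)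
      then show ?thesis
        unfolding sum_distrib_right[symmetric]
        using card_multiples_near_int_le[OF assms(3,1,2), of "real z * x / w"]
        by (intro mult_right_mono) auto
    qed
    show "set_integrable lborel {0..<1} (\<lambda>x. \<Sum>k<w. ?near (real z * x / w + real z * real k / w) * ?near x)"
      unfolding set_integrable_def scaleR_sum_right
      by (rule Bochner_Integration.integrable_sum[OF int[unfolded set_integrable_def]])
    show "set_integrable lborel {0..<1} (\<lambda>x. ?c * ?near x)"
      by (rule integrable_unit_interval[where B = ?c]) (use assms in auto)
  qed
  also have "(LINT x:{0..<1}|lborel. ?c * ?near x) = ?c * (2 * \<psi>)"
    using measure_hits[of 1 \<psi>] set_integral_hits[of 1 \<psi>] assms by simp
  finally show ?thesis
    using assms by (simp add: divide_right_mono field_simps power2_eq_square)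
qed

text \<open>The preceding bound is asymmetric; the larger of the two numbers is put in the role of
  \<open>w\<close>.\<close>

lemma measure_hits_Int_le_max:
  assumes "0 < z" "0 < w" "0 \<le> \<psi>" "\<psi> < 1 / 2"
  shows "measure lborel (hits \<psi> z \<inter> hits \<psi> w) \<le> 4 * \<psi>\<^sup>2 + 2 * \<psi> * (real (gcd z w) / real (max z w))"
  using measure_hits_Int_le[OF assms] measure_hits_Int_le[OF assms(2,1,3,4)]
  by (auto simp: max_def Int_commute gcd.commute)

section \<open>Second moment bound for the points missed by all differences\<close>

definition misses :: "real \<Rightarrow> nat set \<Rightarrow> real set" where
  "misses \<psi> D = {x \<in> {0..<1}. \<forall>z\<in>D. \<psi> < dist_nint (real z * x)}"

lemma misses_eq: "misses \<psi> D = {0..<1} - (\<Union>z\<in>D. hits \<psi> z)"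
  by (auto simp: misses_def hits_def not_le)

lemma misses_measurable [measurable]: "misses \<psi> D \<in> sets borel"
  unfolding misses_eq by (intro sets.Diff sets.countable_UN') auto

text \<open>Let \<open>X\<close> count the \<open>z \<in> D\<close> whose set contains the point;
  its mean is \<open>\<mu>\<close>. On \<open>misses\<close> it vanishes, so
  \<open>(X - \<mu>)\<^sup>2 = \<mu>\<^sup>2\<close> there. In the variance the terms
  \<open>4 * \<psi>\<^sup>2\<close> add up to \<open>\<mu>\<^sup>2\<close> and cancel, leaving at
  most \<open>2 * \<psi> * S\<close>.\<close>

lemma measure_misses_le:
  assumes D: "finite D" "D \<noteq> {}" "\<And>z. z \<in> D \<Longrightarrow> 0 < z" and \<psi>: "0 < \<psi>" "\<psi> < 1 / 2"
  shows "measure lborel (misses \<psi> D) \<le>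
    (\<Sum>w\<in>D. \<Sum>z\<in>D. real (gcd z w) / real (max z w)) / (2 * \<psi> * real (card D) ^ 2)"
proof -
  define m where "m = real (card D)"
  have m: "0 < m" using D by (simp add: m_def card_gt_0_iff)
  define \<mu> where "\<mu> = 2 * \<psi> * m"
  define S where "S = (\<Sum>w\<in>D. \<Sum>z\<in>D. real (gcd z w) / real (max z w))"
  \<comment> \<open>On \<open>{0..<1}\<close> this is \<open>(X - \<mu>)\<^sup>2\<close> multiplied
    out, so that its integral involves only measures of \<open>hits\<close> and of their
    intersections; elsewhere it is 0.\<close>
  define F :: "real \<Rightarrow> real" where "F x = (\<Sum>w\<in>D. \<Sum>z\<in>D. indicator (hits \<psi> z \<inter> hits \<psi> w) x)
      - 2 * \<mu> * (\<Sum>z\<in>D. indicator (hits \<psi> z) x) + \<mu>\<^sup>2 * indicator {0..<1} x" for x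
  have fin: "emeasure lborel A < \<infinity>" if "A \<subseteq> {0..<1}" for A :: "real set"
  proof -
    have "emeasure lborel A \<le> emeasure lborel {0..<1::real}" using that by (intro emeasure_mono) auto
    also have "\<dots> < \<infinity>" by simp
    finally show ?thesis .
  qed
  have sub: "hits \<psi> z \<subseteq> {0..<1}" "misses \<psi> D \<subseteq> {0..<1}" for z by (auto simp: hits_def misses_def)
  have int [simp]: "integrable lborel (indicator (hits \<psi> z) :: real \<Rightarrow> real)"
    "integrable lborel (indicator (hits \<psi> z \<inter> hits \<psi> w) :: real \<Rightarrow> real)"
    "integrable lborel (indicator (misses \<psi> D) :: real \<Rightarrow> real)" for z w
    using sub fin[of "hits \<psi> z"] fin[of "hits \<psi> z \<inter> hits \<psi> w"] fin[of "misses \<psi> D"]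
    by (auto simp: integrable_indicator_iff)
  have int1 [simp]: "integrable lborel (indicator {0..<1} :: real \<Rightarrow> real)"
    by (simp add: integrable_indicator_iff)
  have "\<mu>\<^sup>2 * measure lborel (misses \<psi> D) = (\<integral>x. \<mu>\<^sup>2 * indicator (misses \<psi> D) x \<partial>lborel)"
    by simp
  also have "\<dots> \<le> (\<integral>x. F x \<partial>lborel)"
  proof (rule integral_mono)
    show "integrable lborel F" unfolding F_def by (intro Bochner_Integration.integrable_add
        Bochner_Integration.integrable_diff Bochner_Integration.integrable_sum integrable_mult_right) auto
    fix x :: real
    let ?X = "\<Sum>z\<in>D. indicator (hits \<psi> z) x :: real"
    show "\<mu>\<^sup>2 * indicator (misses \<psi> D) x \<le> F x"
    proof (cases "x \<in> {0..<1}")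
      case True
      have "(\<Sum>w\<in>D. \<Sum>z\<in>D. indicator (hits \<psi> z \<inter> hits \<psi> w) x) = ?X * ?X"
        by (simp add: sum_product indicator_inter_arith mult.commute)
      then have "F x = (?X - \<mu>)\<^sup>2"
        using True by (simp add: F_def power2_eq_square algebra_simps)
      moreover have "?X = 0" if "x \<in> misses \<psi> D"
        using that by (auto simp: misses_eq)
      ultimately show ?thesis by (cases "x \<in> misses \<psi> D") auto
    next
      case False
      then have "x \<notin> hits \<psi> z" "x \<notin> misses \<psi> D" for z by (auto simp: hits_def misses_def)
      then show ?thesis using False by (simp add: F_def)
    qed
  qed simp
  also have "\<dots> = (\<Sum>w\<in>D. \<Sum>z\<in>D. measure lborel (hits \<psi> z \<inter> hits \<psi> w))
      - 2 * \<mu> * (\<Sum>z\<in>D. measure lborel (hits \<psi> z)) + \<mu>\<^sup>2"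
    unfolding F_def by simp
  also have "\<dots> \<le> (\<Sum>w\<in>D. \<Sum>z\<in>D. 4 * \<psi>\<^sup>2 + 2 * \<psi> * (real (gcd z w) / real (max z w)))
      - 2 * \<mu> * (\<Sum>z\<in>D. 2 * \<psi>) + \<mu>\<^sup>2"
  proof -
    have "(\<Sum>w\<in>D. \<Sum>z\<in>D. measure lborel (hits \<psi> z \<inter> hits \<psi> w))
      \<le> (\<Sum>w\<in>D. \<Sum>z\<in>D. 4 * \<psi>\<^sup>2 + 2 * \<psi> * (real (gcd z w) / real (max z w)))"
      using D \<psi> by (intro sum_mono measure_hits_Int_le_max) auto
    moreover have "(\<Sum>z\<in>D. measure lborel (hits \<psi> z)) = (\<Sum>z\<in>D. 2 * \<psi>)"
      using D \<psi> by (intro sum.cong measure_hits) auto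
    ultimately show ?thesis by simp
  qed
  also have "(\<Sum>w\<in>D. \<Sum>z\<in>D. 4 * \<psi>\<^sup>2 + 2 * \<psi> * (real (gcd z w) / real (max z w)))
      = \<mu>\<^sup>2 + 2 * \<psi> * S"
    unfolding sum.distrib sum_distrib_left[symmetric] S_def
    by (simp add: \<mu>_def m_def power_mult_distrib power2_eq_square)
  also have "\<mu>\<^sup>2 + 2 * \<psi> * S - 2 * \<mu> * (\<Sum>z\<in>D. 2 * \<psi>) + \<mu>\<^sup>2 = 2 * \<psi> * S"
    by (simp add: \<mu>_def m_def power2_eq_square)
  finally show ?thesis
    using m \<psi> by (simp add: S_def[symmetric] m_def[symmetric] \<mu>_def power2_eq_square field_simps)
qed

section \<open>Difference sets\<close>

text \<open>The condition \<open>a n < a m\<close> keeps the truncated subtraction exact.\<close>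

definition pos_diffs :: "(nat \<Rightarrow> nat) \<Rightarrow> nat \<Rightarrow> nat set" where
  "pos_diffs a N = {a m - a n | m n. m \<in> {1..N} \<and> n \<in> {1..N} \<and> a n < a m}"

lemma pos_diffs_pos: "z \<in> pos_diffs a N \<Longrightarrow> 0 < z"
  by (auto simp: pos_diffs_def)

lemma pos_diffs_mono: "N \<le> N' \<Longrightarrow> pos_diffs a N \<subseteq> pos_diffs a N'"
  unfolding pos_diffs_def by fastforce

lemma Collect_pairs_eq_image:
  "{f m n | m n. m \<in> {1..N} \<and> n \<in> {1..N}} = (\<lambda>(m, n). f m n) ` ({1..N} \<times> {1..N :: nat})"
  by (fastforce simp: image_iff)

lemma finite_pos_diffs [simp]: "finite (pos_diffs a N)"
  by (rule finite_subset[of _ "(\<lambda>(m, n). a m - a n) ` ({1..N} \<times> {1..N})"]) (auto simp: pos_diffs_def)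

lemma diff_card_le: "diff_card a N \<le> N\<^sup>2"
  unfolding diff_card_def Collect_pairs_eq_image
  by (rule order_trans[OF card_image_le]) (auto simp: power2_eq_square)

text \<open>Zero, \<open>P\<close> and \<open>- P\<close> partition the difference set;
  \<open>1 \<le> N\<close> supplies zero as \<open>a 1 - a 1\<close>.\<close>

lemma diff_card_eq:
  assumes "1 \<le> N"
  shows "diff_card a N = 2 * card (pos_diffs a N) + 1"
proof -
  let ?P = "int ` pos_diffs a N"
  have "{int (a m) - int (a n) | m n. m \<in> {1..N} \<and> n \<in> {1..N}} = insert 0 (?P \<union> uminus ` ?P)"
    (is "?L = ?R")
  proof (intro set_eqI iffI)
    fix x assume "x \<in> ?L"
    then obtain m n where mn: "m \<in> {1..N}" "n \<in> {1..N}" "x = int (a m) - int (a n)" by blast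
    consider "a m = a n" | "a n < a m" | "a m < a n" by linarith
    then show "x \<in> ?R"
    proof cases
      case 2
      then have "a m - a n \<in> pos_diffs a N" "x = int (a m - a n)"
        using mn unfolding pos_diffs_def by auto
      then show ?thesis by blast
    next
      case 3
      then have "a n - a m \<in> pos_diffs a N" "x = - int (a n - a m)"
        using mn unfolding pos_diffs_def by auto
      then show ?thesis by blast
    qed (use mn in auto)
  next
    fix x assume "x \<in> ?R"
    then consider "x = 0" | "x \<in> ?P" | "x \<in> uminus ` ?P" by blast
    then show "x \<in> ?L"
    proof cases
      case 1
      then have "x = int (a 1) - int (a 1)" "1 \<in> {1..N}" using assms by auto
      then show ?thesis by blast
    next
      case 2
      then obtain m n where "m \<in> {1..N}" "n \<in> {1..N}" "a n < a m" "x = int (a m - a n)"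
        by (auto simp: pos_diffs_def)
      moreover from this have "x = int (a m) - int (a n)" by simp
      ultimately show ?thesis by blast
    next
      case 3
      then obtain m n where "m \<in> {1..N}" "n \<in> {1..N}" "a n < a m" "x = - int (a m - a n)"
        by (auto simp: pos_diffs_def)
      moreover from this have "x = int (a n) - int (a m)" by simp
      ultimately show ?thesis by blast
    qed
  qed
  moreover have "card (insert 0 (?P \<union> uminus ` ?P)) = Suc (card ?P + card (uminus ` ?P))"
  proof -
    have "?P \<inter> uminus ` ?P = {}" "0 \<notin> ?P \<union> uminus ` ?P"
      using pos_diffs_pos[of _ a N] by force+
    then show ?thesis by (simp add: card_Un_disjoint)
  qed
  ultimately show ?thesis
    by (simp add: diff_card_def card_image inj_on_def)
qed

text \<open>The differences \<open>a m - a 1\<close> are distinct. Hence every dyadic size of the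
  difference set is eventually exceeded.\<close>

lemma diff_card_ge:
  assumes "\<And>m n. 1 \<le> m \<Longrightarrow> m < n \<Longrightarrow> a m < a n"
  shows "N \<le> diff_card a N"
proof (cases "1 \<le> N")
  case True
  have "inj_on (\<lambda>m. int (a m) - int (a 1)) {1..N}"
    by (rule linorder_inj_onI) (use assms in \<open>force+\<close>)
  moreover have "(\<lambda>m. int (a m) - int (a 1)) ` {1..N} \<subseteq> {int (a m) - int (a n) | m n. m \<in> {1..N} \<and> n \<in> {1..N}}"
    using True by force
  ultimately have "card {1..N} \<le> diff_card a N"
    unfolding diff_card_def by (rule card_inj_on_le) (simp only: Collect_pairs_eq_image, simp)
  then show ?thesis by simp
qed simp

lemma delta_min_le:
  assumes "z \<in> pos_diffs a N"
  shows "delta_min a \<alpha> N \<le> dist_nint (real z * \<alpha>)"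
proof -
  obtain m n where mn: "m \<in> {1..N}" "n \<in> {1..N}" "a n < a m" "z = a m - a n"
    using assms by (auto simp: pos_diffs_def)
  have "finite {dist_nint ((real (a m) - real (a n)) * \<alpha>) | m n. m \<in> {1..N} \<and> n \<in> {1..N} \<and> m \<noteq> n}"
    by (rule finite_subset[of _ "(\<lambda>(m, n). dist_nint ((real (a m) - real (a n)) * \<alpha>)) ` ({1..N} \<times> {1..N})"]) auto
  moreover have "real z = real (a m) - real (a n)" "m \<noteq> n" using mn by auto
  ultimately show ?thesis
    unfolding delta_min_def using mn by (intro Min_le) auto
qed

section \<open>Borel--Cantelli along dyadic sizes of the difference set\<close>

theorem theorem2:
  fixes a :: "nat \<Rightarrow> nat"
  assumes pos: "\<And>n. 1 \<le> n \<Longrightarrow> 0 < a n"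
    and incr: "\<And>m n. 1 \<le> m \<Longrightarrow> m < n \<Longrightarrow> a m < a n"
  shows "\<forall>\<epsilon>>0. AE \<alpha> in lborel. \<alpha> \<in> {0..1} \<longrightarrow>
           (\<forall>\<^sub>F N in sequentially.
              delta_min a \<alpha> N \<le> real N powr \<epsilon> / real (diff_card a N))"
proof (intro allI impI)
  fix \<epsilon> :: real assume \<epsilon>: "0 < \<epsilon>"
  \<comment> \<open>The exponent \<open>\<epsilon> / 4\<close> is doubled by
    \<open>m \<le> l\<^sup>2\<close> below, so only half of \<open>l powr \<epsilon>\<close> is
    spent and a negative power of \<open>l\<close> remains for summability.\<close>
  obtain C where C: "0 < C" and gcd_sum: "\<And>D. finite D \<Longrightarrow> D \<noteq> {} \<Longrightarrow> (\<And>z. z \<in> D \<Longrightarrow> 0 < z) \<Longrightarrow>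
      (\<Sum>w\<in>D. \<Sum>z\<in>D. real (gcd z w) / real (max z w)) \<le> C * real (card D) powr (1 + \<epsilon> / 4)"
    using gcd_sum_bound[of "\<epsilon> / 4"] \<epsilon> by auto
  define L where "L j = (LEAST N. 2 ^ j \<le> diff_card a N)" for j :: nat
  define D where "D j = pos_diffs a (L j)" for j
  \<comment> \<open>The denominator is \<open>2 ^ (j + 1)\<close> so that \<open>\<psi> j\<close> is
    at most the target bound for every \<open>N\<close> with
    \<open>2 ^ j \<le> C_N < 2 ^ (j + 1)\<close>; such \<open>N\<close> satisfy
    \<open>L j \<le> N\<close>.\<close>
  define \<psi> where "\<psi> j = real (L j) powr \<epsilon> / 2 ^ (j + 1)" for j
  have ge: "N \<le> diff_card a N" for N by (rule diff_card_ge) (rule incr)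
  have L: "2 ^ j \<le> diff_card a (L j)" for j
    unfolding L_def by (rule LeastI[of _ "2 ^ j"]) (rule ge)
  have L_le: "L j \<le> N" if "2 ^ j \<le> diff_card a N" for j N
    unfolding L_def using that by (rule Least_le)
  have L_pos: "1 \<le> L j" for j
    using order_trans[OF L[of j] diff_card_le[of a "L j"]] by (cases "L j") auto
  have "measure lborel (misses (\<psi> j) (D j)) \<le> 4 * C * (2 powr (- \<epsilon> / 4)) ^ j" if j: "1 \<le> j" for j
  proof -
    define m l where "m = real (card (D j))" and "l = real (L j)"
    have card: "2 ^ j \<le> 2 * card (D j) + 1" "2 * card (D j) + 1 \<le> L j ^ 2"
      using L[of j] diff_card_le[of a "L j"] unfolding D_def diff_card_eq[OF L_pos] by auto
    have l1: "1 \<le> l" using L_pos[of j] by (simp add: l_def)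
    have "real (2 ^ j) \<le> real (2 * card (D j) + 1)" "real (2 * card (D j) + 1) \<le> real (L j ^ 2)"
      using card by (simp_all only: of_nat_le_iff)
    then have m: "2 ^ j \<le> 2 * m + 1" "2 * m + 1 \<le> l\<^sup>2" by (simp_all add: m_def l_def)
    \<comment> \<open>From \<open>2 ^ j \<ge> 2\<close> follows
      \<open>2 * m \<ge> 2 ^ j - 1 \<ge> 2 ^ j / 2\<close>; at \<open>j = 0\<close> the set
      \<open>D j\<close> would be empty.\<close>
    have "(2::real) ^ 1 \<le> 2 ^ j" using j by (intro power_increasing) auto
    with m have m4: "2 ^ j \<le> 4 * m" and m0: "0 < m" by auto
    then have D: "D j \<noteq> {}" "finite (D j)" by (auto simp: m_def card_gt_0_iff)
    show ?thesis
    proof (cases "\<psi> j < 1 / 2")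
      \<comment> \<open>No distance to the nearest integer exceeds 1/2, so for
        \<open>\<psi> j \<ge> 1 / 2\<close> nothing is missed.\<close>
      case False
      obtain z where "z \<in> D j" using D by blast
      then have "x \<notin> misses (\<psi> j) (D j)" for x
        using False dist_nint_le_half[of "real z * x"] by (force simp: misses_def)
      then have "misses (\<psi> j) (D j) = {}" by blast
      then show ?thesis using C by simp
    next
      case True
      have \<psi>0: "0 < \<psi> j" using l1 by (simp add: \<psi>_def l_def)
      have Dpos: "0 < z" if "z \<in> D j" for z using that by (simp add: D_def pos_diffs_pos)
      have "measure lborel (misses (\<psi> j) (D j)) \<le>
          (\<Sum>w\<in>D j. \<Sum>z\<in>D j. real (gcd z w) / real (max z w)) / (2 * \<psi> j * m\<^sup>2)"
        unfolding m_def using measure_misses_le[OF D(2,1) Dpos \<psi>0 True] .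
      also have "\<dots> \<le> C * m powr (1 + \<epsilon> / 4) / (2 * \<psi> j * m\<^sup>2)"
        using gcd_sum[OF D(2,1) Dpos] \<psi>0 by (intro divide_right_mono) (auto simp: m_def)
      also have "\<dots> = C * (m powr (\<epsilon> / 4) * (2 ^ j / m) / l powr \<epsilon>)"
        using m0 by (simp add: \<psi>_def l_def powr_add power2_eq_square)
      \<comment> \<open>The two size relations \<open>m \<le> l\<^sup>2\<close> and
        \<open>2 ^ j \<le> 4 * m\<close> enter here.\<close>
      also have "\<dots> \<le> C * ((l\<^sup>2) powr (\<epsilon> / 4) * 4 / l powr \<epsilon>)"
        using m m0 m4 C \<epsilon> by (intro mult_left_mono divide_right_mono mult_mono powr_mono2) (auto simp: divide_le_eq)
      \<comment> \<open>Kept as a power of \<open>l\<^sup>2\<close>, since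
        \<open>2 ^ j \<le> l\<^sup>2\<close> then gives a geometric series in
        \<open>j\<close>.\<close>
      also have "\<dots> = 4 * C * (l\<^sup>2) powr (- \<epsilon> / 4)"
      proof -
        have "(l\<^sup>2) powr (\<epsilon> / 2) = l powr \<epsilon>"
        proof -
          have "l\<^sup>2 = l powr 2" using l1 by simp
          then have "(l\<^sup>2) powr (\<epsilon> / 2) = l powr (2 * (\<epsilon> / 2))" by (simp only: powr_powr)
          then show ?thesis by simp
        qed
        moreover have "(l\<^sup>2) powr (- \<epsilon> / 4) = (l\<^sup>2) powr (\<epsilon> / 4) / (l\<^sup>2) powr (\<epsilon> / 2)"
          by (subst powr_diff[symmetric]) simp
        ultimately show ?thesis by simp
      qed
      also have "\<dots> \<le> 4 * C * (2 ^ j) powr (- \<epsilon> / 4)"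
        using m m0 C \<epsilon> by (intro mult_left_mono powr_mono2') auto
      also have "(2 ^ j) powr (- \<epsilon> / 4) = (2 powr (- \<epsilon> / 4)) ^ j"
      proof -
        have "(2 ^ j) powr (- \<epsilon> / 4) = 2 powr (j * (- \<epsilon> / 4))"
          by (subst powr_realpow[symmetric]) (simp, simp only: powr_powr)
        then show ?thesis by (simp add: powr_power mult.commute)
      qed
      finally show ?thesis .
    qed
  qed
  then have "summable (\<lambda>j. measure lborel (misses (\<psi> j) (D j)))"
  proof (intro summable_comparison_test[OF _ summable_mult[OF summable_geometric]])
    show "norm (2 powr (- \<epsilon> / 4)) < 1" using \<epsilon> by (simp add: powr_less_one)
  qed auto
  moreover have "emeasure lborel (misses (\<psi> j) (D j)) < \<infinity>" for j
  proof -
    have "emeasure lborel (misses (\<psi> j) (D j)) \<le> emeasure lborel {0..<1::real}"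
      by (intro emeasure_mono) (auto simp: misses_def)
    also have "\<dots> < \<infinity>" by simp
    finally show ?thesis .
  qed
  ultimately have "AE \<alpha> in lborel. \<forall>\<^sub>F j in sequentially. \<alpha> \<in> space lborel - misses (\<psi> j) (D j)"
    by (intro borel_cantelli_AE1) auto
  \<comment> \<open>\<open>misses\<close> lives in \<open>{0..<1}\<close>, so the right endpoint of
    \<open>{0..1}\<close> is removed separately.\<close>
  moreover have "AE \<alpha> in lborel. \<alpha> \<noteq> (1 :: real)" by (rule AE_lborel_singleton)
  ultimately show "AE \<alpha> in lborel. \<alpha> \<in> {0..1} \<longrightarrow> (\<forall>\<^sub>F N in sequentially.
      delta_min a \<alpha> N \<le> real N powr \<epsilon> / real (diff_card a N))"
  proof (eventually_elim, intro impI)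
    fix \<alpha> :: real
    assume ev: "\<forall>\<^sub>F j in sequentially. \<alpha> \<in> space lborel - misses (\<psi> j) (D j)" and \<alpha>: "\<alpha> \<noteq> 1" "\<alpha> \<in> {0..1}"
    obtain J where J: "\<And>j. J \<le> j \<Longrightarrow> \<alpha> \<notin> misses (\<psi> j) (D j)"
      using ev by (auto simp: eventually_sequentially)
    have "delta_min a \<alpha> N \<le> real N powr \<epsilon> / real (diff_card a N)" if N: "2 ^ J \<le> N" for N
    proof -
      have CN: "2 ^ J \<le> diff_card a N" using N ge[of N] by simp
      \<comment> \<open>\<open>j\<close> is the dyadic level of \<open>C_N\<close>; it is at least
        \<open>J\<close> because \<open>C_N \<ge> N \<ge> 2 ^ J\<close>.\<close>
      then obtain j where j: "2 ^ j \<le> diff_card a N" "diff_card a N < 2 ^ (j + 1)"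
        using ex_power_ivl1[of 2 "diff_card a N"] by (metis le_refl le_trans one_le_numeral one_le_power)
      have "(2::nat) ^ J < 2 ^ (j + 1)" using CN j by linarith
      then have "J \<le> j" using power_less_imp_less_exp[of "2::nat" J "j + 1"] by simp
      then obtain z where z: "z \<in> D j" "dist_nint (real z * \<alpha>) \<le> \<psi> j"
        using J[of j] \<alpha> by (auto simp: misses_def not_less)
      \<comment> \<open>A difference among the first \<open>L j \<le> N\<close> terms is also one
        for \<open>N\<close>; this carries the estimate from the sparse sequence to every large
        \<open>N\<close>.\<close>
      have "z \<in> pos_diffs a N" using z(1) pos_diffs_mono[OF L_le[OF j(1)]] by (auto simp: D_def)
      then have "delta_min a \<alpha> N \<le> \<psi> j" using delta_min_le z(2) order_trans by blast
      also have "\<psi> j \<le> real N powr \<epsilon> / real (diff_card a N)"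
        unfolding \<psi>_def
      proof (rule frac_le)
        show "real (L j) powr \<epsilon> \<le> real N powr \<epsilon>"
          using L_le[OF j(1)] \<epsilon> by (intro powr_mono2) auto
        have "(0::nat) < 2 ^ j" by simp
        then show "0 < real (diff_card a N)" using j(1) by linarith
        have "real (diff_card a N) \<le> real (2 ^ (j + 1))" using j(2) by (intro of_nat_mono) simp
        then show "real (diff_card a N) \<le> 2 ^ (j + 1)" by simp
      qed simp
      finally show ?thesis .
    qed
    then show "\<forall>\<^sub>F N in sequentially. delta_min a \<alpha> N \<le> real N powr \<epsilon> / real (diff_card a N)"
      by (auto simp: eventually_sequentially)
  qed
qed

end
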